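(* Let $G$ be a non-bipartite graph and let $r,s$ be non-negative integers. Then $$\chi_c\big(G^{\frac{1}{2s+1}}\big)=\frac{(2s+1)\chi_c(G)}{s\chi_c(G)+1}.$$ Moreover, if $\chi_c\big(G^{\frac{2r+1}{2s+1}}\big)<4$, then $$\chi_c\big(G^{\frac{2r+1}{2s+1}}\big)=\frac{(2s+1)\chi_c(G)}{(s-r)\chi_c(G)+2r+1}.$$
   Context: All graphs are finite simple graphs. For positive integers $n\ge 2d$, the circular complete graph $K_{n/d}$ has vertex set $\{0,\dots,n-1\}$ with $ij$ an edge iff $d\le|i-j|\le n-d$. The circular chromatic number is $\chi_c(G)=\inf\{\frac nd : G\to K_{n/d}\}$, where $G\to H$ means there is a graph homomorphism. For a positive integer $k$, $G^{k}$ is the graph on $V(G)$ in which $u,v$ are adjacent iff there is a walk of length exactly $k$ between them in $G$ (a vertex lying on a closed walk of length $k$ receives a loop, so that the graph then has no homomorphism to any loopless graph). For a positive integer $s$, $G^{1/s}$ is obtained from $G$ by replacing each edge by a path with $s$ edges, and $G^{r/s}=(G^{1/s})^{r}$. *)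

theory Defs
  imports "Graph_Theory.Pair_Digraph" "HOL-Library.Extended_Real"
begin

text \<open>
  A finite simple graph is a \<^locale>\<open>pair_graph\<close>: a finite, symmetric, loop-free digraph without
  parallel arcs.  An undirected edge is thus a pair of opposite arcs.  Graph powers may have loops,
  so they live in \<^typ>\<open>'a pair_pre_digraph\<close> but need not be a \<^locale>\<open>pair_graph\<close>.
\<close>

definition bipartite :: "'a pair_pre_digraph \<Rightarrow> bool" where
  "bipartite G \<longleftrightarrow>
    (\<exists>A B. pverts G = A \<union> B \<and> A \<inter> B = {} \<and> parcs G \<subseteq> A \<times> B \<union> B \<times> A)"

definition homomorphic_to :: "'a pair_pre_digraph \<Rightarrow> 'b pair_pre_digraph \<Rightarrow> bool" where
  "homomorphic_to G H \<longleftrightarrow>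
    (\<exists>f. f \<in> pverts G \<rightarrow> pverts H \<and> (\<forall>(u, v) \<in> parcs G. (f u, f v) \<in> parcs H))"

definition circular_complete :: "nat \<Rightarrow> nat \<Rightarrow> nat pair_pre_digraph" where
  "circular_complete n d =
    \<lparr> pverts = {0..<n},
      parcs = {(i, j). i < n \<and> j < n \<and>
        int d \<le> \<bar>int i - int j\<bar> \<and> \<bar>int i - int j\<bar> \<le> int n - int d} \<rparr>"

text \<open>
  The value is extended real, so that the infimum of the empty set is \<open>\<infinity>\<close>: this is the circular
  chromatic number of a graph with a loop, which must not count as being less than 4.
\<close>

definition circular_chromatic :: "'a pair_pre_digraph \<Rightarrow> ereal" where
  "circular_chromatic G =
    Inf {ereal (real n / real d) | n d.
           0 < d \<and> 2 * d \<le> n \<and> homomorphic_to G (circular_complete n d)}"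

definition graph_power :: "'a pair_pre_digraph \<Rightarrow> nat \<Rightarrow> 'a pair_pre_digraph" where
  "graph_power G k =
    \<lparr> pverts = pverts G,
      parcs = {(u, v). \<exists>p. pre_digraph.awalk (with_proj G) u p v \<and> length p = k} \<rparr>"

text \<open>
  \<open>subdivision_point s u v i\<close> is the point at distance \<open>i\<close> from \<open>u\<close> on the path of length \<open>s > 0\<close>
  that replaces the edge \<open>uv\<close>.  Original vertices are tagged by \<open>Inl\<close>.  An inner point is
  recorded by its distances to both ends, so it is the same point whether the edge is read as
  \<open>uv\<close> or \<open>vu\<close>.
\<close>

definition subdivision_point :: "nat \<Rightarrow> 'a \<Rightarrow> 'a \<Rightarrow> nat \<Rightarrow> 'a + ('a \<times> nat) set" where
  "subdivision_point s u v i =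
    (if i = 0 then Inl u else if i = s then Inl v else Inr {(u, i), (v, s - i)})"

lemma subdivision_point_sym:
  "i \<le> s \<Longrightarrow> 0 < s \<Longrightarrow> subdivision_point s v u (s - i) = subdivision_point s u v i"
  by (auto simp: subdivision_point_def)

definition edge_subdivision ::
  "'a pair_pre_digraph \<Rightarrow> nat \<Rightarrow> ('a + ('a \<times> nat) set) pair_pre_digraph" where
  "edge_subdivision G s =
    \<lparr> pverts = Inl ` pverts G \<union>
        {subdivision_point s u v i | u v i. (u, v) \<in> parcs G \<and> 0 < i \<and> i < s},
      parcs = {(subdivision_point s u v i, subdivision_point s u v (Suc i)) | u v i.
        (u, v) \<in> parcs G \<and> i < s} \<rparr>"

lemma pair_graph_circular_complete:
  assumes "0 < d"
  shows "pair_graph (circular_complete n d)"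
proof
  have "parcs (circular_complete n d) \<subseteq> {0..<n} \<times> {0..<n}"
    by (auto simp: circular_complete_def)
  then show "finite (parcs (circular_complete n d))"
    by (rule finite_subset) simp
qed (use assms in \<open>auto simp: circular_complete_def symmetric_def abs_minus_commute intro!: symI\<close>)

lemma pair_graph_edge_subdivision:
  assumes "pair_graph G" "0 < s"
  shows "pair_graph (edge_subdivision G s)"
proof -
  interpret pair_graph G by fact
  let ?H = "edge_subdivision G s"
  have arcI: "(subdivision_point s u v i, subdivision_point s u v (Suc i)) \<in> parcs ?H"
    if "(u, v) \<in> parcs G" "i < s" for u v i
    using that by (auto simp: edge_subdivision_def)
  have mem: "subdivision_point s u v i \<in> pverts ?H" if "(u, v) \<in> parcs G" "i \<le> s" for u v i
  proof (cases "i = 0 \<or> i = s")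
    case True
    then show ?thesis
      using in_arcsD1[OF that(1)] in_arcsD2[OF that(1)]
      by (auto simp: edge_subdivision_def subdivision_point_def)
  next
    case False
    then have "0 < i" "i < s" using that by auto
    then show ?thesis using that(1) unfolding edge_subdivision_def by auto
  qed
  have wf: "parcs ?H \<subseteq> pverts ?H \<times> pverts ?H"
  proof
    fix e assume "e \<in> parcs ?H"
    then obtain u v i where
      "e = (subdivision_point s u v i, subdivision_point s u v (Suc i))" "(u, v) \<in> parcs G" "i < s"
      by (auto simp: edge_subdivision_def)
    then show "e \<in> pverts ?H \<times> pverts ?H" by (simp add: mem)
  qed
  have "pverts ?H \<subseteq> Inl ` pverts G \<union> (\<lambda>(e, i). subdivision_point s (fst e) (snd e) i) ` (parcs G \<times> {..<s})"
    by (force simp: edge_subdivision_def)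
  then have fin: "finite (pverts ?H)"
    by (rule finite_subset) (simp add: pair_finite_verts pair_finite_arcs)
  have sym: "(y, x) \<in> parcs ?H" if "(x, y) \<in> parcs ?H" for x y
  proof -
    from that obtain u v i where *: "x = subdivision_point s u v i"
      "y = subdivision_point s u v (Suc i)" "(u, v) \<in> parcs G" "i < s"
      by (auto simp: edge_subdivision_def)
    have "(v, u) \<in> parcs G"
      using arcs_symmetric[OF *(3)] .
    from arcI[OF this, of "s - Suc i"] show ?thesis
      using * assms(2) subdivision_point_sym[of "Suc i" s v u] subdivision_point_sym[of i s v u]
      by (simp add: Suc_diff_Suc)
  qed
  have irrefl: "x \<noteq> y" if "(x, y) \<in> parcs ?H" for x y
    using that no_loops'
    by (auto simp: edge_subdivision_def subdivision_point_def doubleton_eq_iff split: if_splits)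
  show ?thesis
  proof
    show "finite (pverts ?H)" by (fact fin)
    show "finite (parcs ?H)" using wf fin finite_subset by blast
    show "symmetric (with_proj ?H)" using sym by (auto simp: symmetric_def intro!: symI)
  qed (use wf irrefl in auto)
qed

end

theory Submission
  imports Defs
begin

text \<open>
  Identify the circle with \<open>\<real>/\<int>\<close>.  A homomorphism to \<open>K\<^bsub>n/d\<^esub>\<close> amounts to a map from the vertices
  to the circle sending the ends of each edge to antipodal points up to an error
  \<open>\<epsilon> = 1/2 - d/n\<close>, so \<open>\<chi>\<^sub>c = 1 / (1/2 - e)\<close> where \<open>e\<close> is the infimum of the admissible errors.
  Along a walk of odd length \<open>k\<close> the errors add up to at most \<open>k\<epsilon>\<close>, and interpolating along the
  subdivided edges shows that subdivision divides \<open>e\<close> by \<open>2s+1\<close>.  Conversely, if \<open>\<epsilon> < 1/4\<close> is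
  admissible for the \<open>k\<close>-th power, then differences of colours along walks of length at most \<open>k\<close>
  lift consistently from the circle to \<open>\<real>\<close>, and McShane's formula
  \<open>g u = inf (f w + m \<epsilon> / k)\<close>, over walks of length \<open>m < k\<close> from \<open>u\<close> to \<open>w\<close>, produces a colouring of
  the graph itself with error \<open>\<epsilon>/k\<close>.
\<close>

text \<open>Points of the circle are given by real representatives, and \<open>z\<close> absorbs
  their choice. A relation rather than a graph is coloured, so that \<open>R ^^ k\<close> is covered
  as well.\<close>

definition antipodal_coloring :: "('a \<times> 'a) set \<Rightarrow> real \<Rightarrow> ('a \<Rightarrow> real) \<Rightarrow> bool" where
  "antipodal_coloring R \<epsilon> f \<longleftrightarrow> (\<forall>u v. (u, v) \<in> R \<longrightarrow> (\<exists>z::int. \<bar>f v - f u - 1/2 - z\<bar> \<le> \<epsilon>))"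

text \<open>Every map has error \<open>1/2\<close>, and at a loop no smaller error is possible. The
  strict bound therefore makes this set empty when \<open>R\<close> has a loop.\<close>

definition antipodal_errors :: "('a \<times> 'a) set \<Rightarrow> real set" where
  "antipodal_errors R = {\<epsilon>. 0 \<le> \<epsilon> \<and> \<epsilon> < 1/2 \<and> (\<exists>f. antipodal_coloring R \<epsilon> f)}"

definition centered :: "real \<Rightarrow> real" where
  "centered t = t - of_int (round t)"

section \<open>Centered representatives modulo 1\<close>

lemma abs_centered_le: "\<bar>centered t\<bar> \<le> \<bar>t - of_int z\<bar>"
  unfolding centered_def by (metis round_diff_minimal)

lemma abs_centered_le_half: "\<bar>centered t\<bar> \<le> 1/2"
  unfolding centered_def by (metis abs_minus_commute of_int_round_abs_le)

text \<open>The defect of additivity is always an integer; once its absolute value is below 1 it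
  vanishes. This is how differences on the circle lift consistently to the reals.\<close>

lemma centered_add:
  assumes "\<bar>centered a\<bar> + \<bar>centered b\<bar> + \<bar>centered c\<bar> < 1" "c = a + b + of_int z"
  shows "centered c = centered a + centered b"
proof -
  have eq: "centered c - centered a - centered b = of_int (z - round c + round a + round b)"
    using assms(2) by (simp add: centered_def)
  have "\<bar>real_of_int (z - round c + round a + round b)\<bar> < 1"
    unfolding eq[symmetric] using assms(1) by linarith
  then have "z - round c + round a + round b = 0" by linarith
  then show ?thesis using eq by simp
qed

lemma abs_centered_diff_le: "\<bar>centered (a - b)\<bar> \<le> \<bar>centered a\<bar> + \<bar>centered b\<bar>"
  using abs_centered_le[of "a - b" "round a - round b"] by (simp add: centered_def)

section \<open>Colourings and walks\<close>

lemma antipodal_coloring_relpow: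
  assumes "antipodal_coloring R \<epsilon> f" "(u, v) \<in> R ^^ k"
  shows "\<exists>z::int. \<bar>f v - f u - real k / 2 - z\<bar> \<le> real k * \<epsilon>"
  using assms(2)
proof (induction k arbitrary: v)
  case 0
  then show ?case by (auto intro: exI[of _ 0])
next
  case (Suc k)
  then obtain w where w: "(u, w) \<in> R ^^ k" "(w, v) \<in> R" by auto
  obtain y :: int where y: "\<bar>f w - f u - real k / 2 - y\<bar> \<le> real k * \<epsilon>"
    using Suc.IH[OF w(1)] by blast
  obtain z :: int where z: "\<bar>f v - f w - 1/2 - z\<bar> \<le> \<epsilon>"
    using assms(1) w(2) by (auto simp: antipodal_coloring_def)
  have "\<bar>f v - f u - real (Suc k) / 2 - of_int (y + z)\<bar> \<le> real (Suc k) * \<epsilon>"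
    using y z by (simp add: field_simps)
  then show ?case by blast
qed

text \<open>For odd \<open>k\<close> the accumulated shift \<open>k/2\<close> is \<open>1/2\<close>
  up to an integer, so walks of length \<open>k\<close> again join nearly antipodal points.\<close>

lemma antipodal_coloring_odd_relpow:
  assumes "antipodal_coloring R \<epsilon> f" "odd k"
  shows "antipodal_coloring (R ^^ k) (real k * \<epsilon>) f"
  unfolding antipodal_coloring_def
proof (intro allI impI)
  fix u v assume "(u, v) \<in> R ^^ k"
  from antipodal_coloring_relpow[OF assms(1) this] obtain z :: int where
    z: "\<bar>f v - f u - real k / 2 - z\<bar> \<le> real k * \<epsilon>" by blast
  obtain j where j: "k = 2 * j + 1" using assms(2) by (auto elim: oddE)
  have "\<bar>f v - f u - 1/2 - of_int (z + int j)\<bar> \<le> real k * \<epsilon>"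
  proof -
    have "f v - f u - 1/2 - of_int (z + int j) = f v - f u - real k / 2 - z"
      by (simp add: j field_simps)
    then show ?thesis using z by simp
  qed
  then show "\<exists>z::int. \<bar>f v - f u - 1/2 - z\<bar> \<le> real k * \<epsilon>" by blast
qed

text \<open>Going back and forth along the last edge adds two steps; \<open>0 < m\<close> provides
  such an edge.\<close>

lemma relpow_add_even:
  assumes "sym R" "(u, w) \<in> R ^^ m" "0 < m"
  shows "(u, w) \<in> R ^^ (m + 2 * j)"
proof (induction j)
  case 0
  then show ?case using assms by simp
next
  case (Suc j)
  obtain x where x: "(x, w) \<in> R"
    using assms(2,3) by (cases m) auto
  then have "(w, x) \<in> R" using assms(1) by (meson symD)
  then have "(u, w) \<in> R ^^ Suc (Suc (m + 2 * j))"
    using Suc x by (meson relpow_Suc_I)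
  then show ?case by simp
qed

lemma antipodal_coloring_root:
  assumes "sym R" "odd K" "antipodal_coloring (R ^^ K) \<epsilon> f" "0 \<le> \<epsilon>" "\<epsilon> < 1/4"
  shows "\<exists>g. antipodal_coloring R (\<epsilon> / real K) g"
proof -
  \<comment> \<open>\<open>D m u w\<close> lifts the colour difference along a walk of length
    \<open>m\<close>, after removing the expected shift of \<open>1/2\<close> per step.\<close>
  define D where "D m u w = centered (f w - f u - real m / 2)" for m u w
  have K: "0 < K" using assms(2) by (cases K) auto
  have D_odd: "\<bar>D m u w\<bar> \<le> \<epsilon>" if "(u, w) \<in> R ^^ m" "odd m" "m \<le> K" for m u w
  proof -
    have "even (K - m)" using that assms(2) by simp
    then obtain j where "K - m = 2 * j" by blast
    then have "K = m + 2 * j" using that(3) by simp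
    moreover have "0 < m" using that(2) by (cases m) auto
    ultimately have "(u, w) \<in> R ^^ K" using relpow_add_even[OF assms(1) that(1)] by simp
    then obtain z :: int where z: "\<bar>f w - f u - 1/2 - z\<bar> \<le> \<epsilon>"
      using assms(3) by (auto simp: antipodal_coloring_def)
    obtain q where q: "m = 2 * q + 1" using \<open>odd m\<close> by (auto elim: oddE)
    have "f w - f u - real m / 2 - of_int (z - int q) = f w - f u - 1/2 - z"
      by (simp add: q field_simps)
    then show ?thesis
      using abs_centered_le[of "f w - f u - real m / 2" "z - int q"] z by (simp add: D_def)
  qed
  \<comment> \<open>An even walk is an odd walk, one step longer, minus its last edge; each of these
    two odd walks contributes at most \<open>\<epsilon>\<close>.\<close>
  have D_even: "\<bar>D m u w\<bar> \<le> 2 * \<epsilon>" if "(u, w) \<in> R ^^ m" "even m" "m < K" for m u w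
  proof (cases m)
    case 0
    then show ?thesis using that assms(4) by (simp add: D_def centered_def)
  next
    case (Suc m')
    with \<open>(u, w) \<in> R ^^ m\<close> obtain x where "(x, w) \<in> R" by auto
    then have x: "(w, x) \<in> R" using assms(1) by (meson symD)
    have 1: "\<bar>D (Suc m) u x\<bar> \<le> \<epsilon>"
      using that relpow_Suc_I[OF that(1) x] by (intro D_odd) auto
    have 2: "\<bar>D 1 w x\<bar> \<le> \<epsilon>"
      using x K by (intro D_odd) auto
    have "f w - f u - real m / 2 = (f x - f u - real (Suc m) / 2) - (f x - f w - real 1 / 2)"
      by (simp add: field_simps)
    then have "\<bar>D m u w\<bar> \<le> \<bar>D (Suc m) u x\<bar> + \<bar>D 1 w x\<bar>"
      unfolding D_def by (metis abs_centered_diff_le)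
    then show ?thesis using 1 2 by linarith
  qed
  have D_add: "D (Suc m) u w = D 1 u v + D m v w"
    if "(u, v) \<in> R" "(v, w) \<in> R ^^ m" "m < K" for m u v w
  proof -
    have uw: "(u, w) \<in> R ^^ Suc m" using that by (meson relpow_Suc_I2)
    have uv: "\<bar>D 1 u v\<bar> \<le> \<epsilon>" using that(1) K by (intro D_odd) auto
    \<comment> \<open>Exactly one of \<open>m\<close> and \<open>Suc m\<close> is even, so the sum
      is at most \<open>\<epsilon> + \<epsilon> + 2 * \<epsilon>\<close>. This is where
      \<open>\<epsilon> < 1/4\<close> enters.\<close>
    have "\<bar>D 1 u v\<bar> + \<bar>D m v w\<bar> + \<bar>D (Suc m) u w\<bar> < 1"
    proof (cases "even m")
      case True
      then show ?thesis
        using uv D_even[OF that(2)] D_odd[OF uw] that(3) assms(5) by simp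
    next
      case False
      with that(3) assms(2) have "Suc m < K" by (metis Suc_lessI even_Suc)
      then show ?thesis
        using False uv D_odd[OF that(2)] D_even[OF uw] assms(5) by simp
    qed
    then show ?thesis
      unfolding D_def by (rule centered_add[where z = 0]) (simp add: field_simps)
  qed
  \<comment> \<open>These are the values in McShane's formula measured relative to
    \<open>f u\<close>, with colours replaced by lifted differences. Their infimum
    \<open>\<sigma> u\<close> is the correction to be added to \<open>f u\<close>.\<close>
  define S where "S u = {D m u w + real m * \<epsilon> / real K | m w. m < K \<and> (u, w) \<in> R ^^ m}" for u
  have S_mem: "D m u w + real m * \<epsilon> / real K \<in> S u" if "(u, w) \<in> R ^^ m" "m < K" for m u w
    using that unfolding S_def by blast
  have S_ne: "S u \<noteq> {}" for u using S_mem[of u u 0] K by auto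
  have S_bdd: "bdd_below (S u)" for u
  proof (rule bdd_belowI)
    fix x assume "x \<in> S u"
    then obtain m w where x: "x = D m u w + real m * \<epsilon> / real K" unfolding S_def by blast
    have "- (1/2) \<le> D m u w" using abs_centered_le_half[of "f w - f u - real m / 2"]
      unfolding D_def by linarith
    moreover have "0 \<le> real m * \<epsilon> / real K" using assms(4) by simp
    ultimately show "- (1/2) \<le> x" using x by linarith
  qed
  define \<sigma> where "\<sigma> u = Inf (S u)" for u
  have \<sigma>_le: "\<sigma> u \<le> D m u w + real m * \<epsilon> / real K" if "(u, w) \<in> R ^^ m" "m < K" for m u w
    unfolding \<sigma>_def using S_mem[OF that] S_bdd by (rule cInf_lower)
  have step: "\<sigma> u \<le> D 1 u v + \<sigma> v + \<epsilon> / real K" if uv: "(u, v) \<in> R" for u v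
  proof -
    have "\<sigma> u - D 1 u v - \<epsilon> / real K \<le> Inf (S v)"
    proof (rule cInf_greatest[OF S_ne])
      fix x assume "x \<in> S v"
      then obtain m w where x: "x = D m v w + real m * \<epsilon> / real K" "m < K" "(v, w) \<in> R ^^ m"
        unfolding S_def by blast
      have uw: "(u, w) \<in> R ^^ Suc m" using uv x(3) by (meson relpow_Suc_I2)
      have sum: "D (Suc m) u w + real (Suc m) * \<epsilon> / real K = D 1 u v + x + \<epsilon> / real K"
        using D_add[OF uv x(3,2)] x(1) by (simp add: field_simps add_divide_distrib)
      have "\<sigma> u \<le> D (Suc m) u w + real (Suc m) * \<epsilon> / real K"
      proof (cases "Suc m < K")
        case True
        then show ?thesis using \<sigma>_le[OF uw] by simp
      next
        \<comment> \<open>The prolonged walk has length \<open>K\<close> and is not among those in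
          \<open>S u\<close>. Its value is still at least
          \<open>- \<epsilon> + \<epsilon> = 0\<close>, the value of the empty walk at
          \<open>u\<close>.\<close>
        case False
        with x(2) have m: "Suc m = K" by simp
        have "\<sigma> u \<le> 0" using \<sigma>_le[of u u 0] K by (simp add: D_def centered_def)
        moreover have "- \<epsilon> \<le> D (Suc m) u w" using D_odd[OF uw] m assms(2) by simp
        moreover have "real (Suc m) * \<epsilon> / real K = \<epsilon>" unfolding m using K by simp
        ultimately show ?thesis by linarith
      qed
      then show "\<sigma> u - D 1 u v - \<epsilon> / real K \<le> x" using sum by linarith
    qed
    then show ?thesis unfolding \<sigma>_def[of v] by linarith
  qed
  have "antipodal_coloring R (\<epsilon> / real K) (\<lambda>u. f u + \<sigma> u)"
    unfolding antipodal_coloring_def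
  proof (intro allI impI)
    fix u v assume uv: "(u, v) \<in> R"
    then have vu: "(v, u) \<in> R" using assms(1) by (meson symD)
    have "\<bar>D 1 u v\<bar> \<le> \<epsilon>" "\<bar>D 1 v u\<bar> \<le> \<epsilon>" using uv vu K by (auto intro!: D_odd)
    \<comment> \<open>The two centered arguments add up to \<open>-1\<close>, hence
      \<open>z = 1\<close>. Antisymmetry turns the one-sided estimate \<open>step\<close>, used in
      both directions, into a bound on the absolute value.\<close>
    then have "centered 0 = D 1 u v + D 1 v u"
      unfolding D_def using assms(5)
      by (intro centered_add[where z = 1]) (auto simp: centered_def)
    then have anti: "D 1 v u = - D 1 u v" by (simp add: centered_def)
    have "\<bar>D 1 u v + \<sigma> v - \<sigma> u\<bar> \<le> \<epsilon> / real K"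
      using step[OF uv] step[OF vu] anti by linarith
    moreover have "(f v + \<sigma> v) - (f u + \<sigma> u) - 1/2 - of_int (round (f v - f u - 1/2))
        = D 1 u v + \<sigma> v - \<sigma> u"
      by (simp add: D_def centered_def)
    ultimately show "\<exists>z::int. \<bar>(f v + \<sigma> v) - (f u + \<sigma> u) - 1/2 - z\<bar> \<le> \<epsilon> / real K"
      by metis
  qed
  then show ?thesis by blast
qed

section \<open>Subdivisions\<close>

lemma sym_parcs:
  assumes "pair_graph G"
  shows "sym (parcs G)"
proof -
  interpret pair_graph G by fact
  show ?thesis using arcs_symmetric by (auto intro: symI)
qed

lemma subdivision_point_relpow:
  assumes "(u, v) \<in> parcs G" "i \<le> s"
  shows "(subdivision_point s u v 0, subdivision_point s u v i) \<in> parcs (edge_subdivision G s) ^^ i"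
  using assms(2)
proof (induction i)
  case (Suc i)
  then have "(subdivision_point s u v i, subdivision_point s u v (Suc i)) \<in> parcs (edge_subdivision G s)"
    using assms(1) unfolding edge_subdivision_def pair_pre_digraph.select_convs mem_Collect_eq
    by (intro exI[of _ u] exI[of _ v] exI[of _ i]) simp
  with Suc show ?case by auto
qed simp

text \<open>Restrict to the original vertices: each edge of \<open>G\<close> has become a walk with
  an odd number \<open>s\<close> of steps.\<close>

lemma antipodal_coloring_of_subdivision:
  assumes "antipodal_coloring (parcs (edge_subdivision G s)) \<epsilon> h" "odd s"
  shows "antipodal_coloring (parcs G) (real s * \<epsilon>) (\<lambda>u. h (Inl u))"
  unfolding antipodal_coloring_def
proof (intro allI impI)
  fix u v assume "(u, v) \<in> parcs G"
  from subdivision_point_relpow[OF this, of s s]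
  have "(Inl u, Inl v) \<in> parcs (edge_subdivision G s) ^^ s"
    using assms(2) by (auto simp: subdivision_point_def split: if_splits)
  then show "\<exists>z::int. \<bar>h (Inl v) - h (Inl u) - 1/2 - z\<bar> \<le> real s * \<epsilon>"
    using antipodal_coloring_odd_relpow[OF assms] by (auto simp: antipodal_coloring_def)
qed

text \<open>Each step along the path of \<open>uv\<close> advances by
  \<open>1/2 + \<delta> u v / s\<close>. Since \<open>s\<close> is odd, the path ends at
  \<open>f v\<close> modulo 1. The bound \<open>\<epsilon> < 1/2\<close> makes
  \<open>\<delta>\<close> antisymmetric, so both readings of the edge give the same colours modulo
  1.\<close>

lemma antipodal_coloring_subdivision:
  assumes "sym (parcs G)" "antipodal_coloring (parcs G) \<epsilon> f" "\<epsilon> < 1/2" "odd s"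
  shows "\<exists>h. antipodal_coloring (parcs (edge_subdivision G s)) (\<epsilon> / real s) h"
proof -
  define \<delta> where "\<delta> u v = centered (f v - f u - 1/2)" for u v
  define H where "H u v i = f u + real i / 2 + real i * \<delta> u v / real s" for u v and i :: nat
  \<comment> \<open>An inner point does not tell in which direction its edge is read;
    \<open>P\<close> chooses one reading, and \<open>H_sym\<close> makes the choice harmless modulo
    1.\<close>
  define P where "P x = (SOME (u, v, i). (u, v) \<in> parcs G \<and> 0 < i \<and> i < s
      \<and> x = subdivision_point s u v i)" for x
  define h where "h x = (case x of Inl u \<Rightarrow> f u | Inr _ \<Rightarrow> (case P x of (u, v, i) \<Rightarrow> H u v i))" for x
  have s: "0 < s" using assms(4) by (cases s) auto
  obtain q where q: "s = 2 * q + 1" using assms(4) by (auto elim: oddE)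
  have \<delta>_le: "\<bar>\<delta> u v\<bar> \<le> \<epsilon>" if uv: "(u, v) \<in> parcs G" for u v
  proof -
    obtain z :: int where "\<bar>f v - f u - 1/2 - z\<bar> \<le> \<epsilon>"
      using assms(2) uv by (auto simp: antipodal_coloring_def)
    then show ?thesis using abs_centered_le unfolding \<delta>_def by (meson order_trans)
  qed
  have \<delta>_sym: "\<delta> v u = - \<delta> u v" if uv: "(u, v) \<in> parcs G" for u v
  proof -
    have "(v, u) \<in> parcs G" using assms(1) uv by (meson symD)
    then have "centered 0 = \<delta> u v + \<delta> v u"
      unfolding \<delta>_def using assms(3) \<delta>_le[OF uv] \<delta>_le[of v u]
      by (intro centered_add[where z = 1]) (auto simp: centered_def \<delta>_def)
    then show ?thesis by (simp add: centered_def)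
  qed
  have H_end: "\<exists>z::int. H u v s = f v + z" if "(u, v) \<in> parcs G" for u v
  proof -
    have "H u v s = f v + of_int (int q - round (f v - f u - 1/2))"
      using s by (simp add: H_def \<delta>_def centered_def) (simp add: q field_simps)
    then show ?thesis by blast
  qed
  have H_sym: "\<exists>z::int. H v u (s - i) = H u v i + z" if uv: "(u, v) \<in> parcs G" "i \<le> s" for u v i
  proof -
    have "H v u (s - i) = f v + (real s - real i) / 2 - (real s - real i) * \<delta> u v / real s"
      using \<delta>_sym[OF uv(1)] uv(2) by (simp add: H_def of_nat_diff)
    also have "\<dots> = f v + (real s - real i) / 2 - \<delta> u v + real i * \<delta> u v / real s"
      using s by (simp add: field_simps)
    also have "\<dots> = H u v i + of_int (round (f v - f u - 1/2) + int q + 1 - int i)"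
      by (simp add: H_def \<delta>_def centered_def q field_simps)
    finally show ?thesis by blast
  qed
  have h_point: "\<exists>z::int. h (subdivision_point s u v i) = H u v i + z"
    if uv: "(u, v) \<in> parcs G" "i \<le> s" for u v i
  proof -
    consider "i = 0" | "i = s" | "0 < i" "i < s" using uv by linarith
    then show ?thesis
    proof cases
      case 1
      then show ?thesis by (intro exI[of _ 0]) (simp add: subdivision_point_def h_def H_def)
    next
      case 2
      obtain z :: int where "H u v s = f v + z" using H_end[OF uv(1)] by blast
      then show ?thesis using 2 s
        by (intro exI[of _ "- z"]) (simp add: subdivision_point_def h_def)
    next
      case 3
      let ?x = "subdivision_point s u v i"
      obtain u' v' i' where P: "P ?x = (u', v', i')" by (metis prod_cases3)
      have "case P ?x of (u', v', i') \<Rightarrow> (u', v') \<in> parcs G \<and> 0 < i' \<and> i' < s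
          \<and> ?x = subdivision_point s u' v' i'"
        unfolding P_def by (rule someI[of _ "(u, v, i)"]) (use uv 3 in simp)
      then have *: "(u', v') \<in> parcs G" "0 < i'" "i' < s" "?x = subdivision_point s u' v' i'"
        using P by auto
      have h: "h ?x = H u' v' i'" using 3 P by (simp add: h_def subdivision_point_def)
      \<comment> \<open>The unordered pair of end-distance records determines the reading up to
        reversal.\<close>
      have "(u' = u \<and> v' = v \<and> i' = i) \<or> (u' = v \<and> v' = u \<and> i' = s - i)"
        using * 3 by (auto simp: subdivision_point_def doubleton_eq_iff)
      then show ?thesis
        using h H_sym[OF uv] by (auto intro: exI[of _ 0])
    qed
  qed
  have "antipodal_coloring (parcs (edge_subdivision G s)) (\<epsilon> / real s) h"
    unfolding antipodal_coloring_def
  proof (intro allI impI)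
    fix x y assume "(x, y) \<in> parcs (edge_subdivision G s)"
    then obtain u v i where xy: "x = subdivision_point s u v i" "y = subdivision_point s u v (Suc i)"
      "(u, v) \<in> parcs G" "i < s" by (auto simp: edge_subdivision_def)
    obtain a :: int where a: "h x = H u v i + a" using h_point[of u v i] xy by auto
    obtain b :: int where b: "h y = H u v (Suc i) + b" using h_point[of u v "Suc i"] xy by auto
    have "h y - h x - 1/2 - of_int (b - a) = \<delta> u v / real s"
      unfolding a b H_def by (simp add: add_divide_distrib distrib_right)
    moreover have "\<bar>\<delta> u v / real s\<bar> \<le> \<epsilon> / real s"
      using \<delta>_le[OF xy(3)] s by (simp add: divide_right_mono)
    ultimately show "\<exists>z::int. \<bar>h y - h x - 1/2 - z\<bar> \<le> \<epsilon> / real s" by metis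
  qed
  then show ?thesis by blast
qed

section \<open>The circular chromatic number\<close>

text \<open>Place colour \<open>i\<close> at \<open>i/n\<close>. Adjacent colours then differ by an
  amount between \<open>d/n\<close> and \<open>1 - d/n\<close>, an interval of radius
  \<open>1/2 - d/n\<close> around \<open>1/2\<close>.\<close>

lemma antipodal_errors_if_homomorphic:
  assumes "homomorphic_to G (circular_complete n d)" "0 < d" "2 * d \<le> n"
  shows "1/2 - real d / real n \<in> antipodal_errors (parcs G)"
proof -
  obtain c where c: "\<And>u v. (u, v) \<in> parcs G \<Longrightarrow> (c u, c v) \<in> parcs (circular_complete n d)"
    using assms(1) unfolding homomorphic_to_def by blast
  have n: "0 < n" using assms by simp
  have "antipodal_coloring (parcs G) (1/2 - real d / real n) (\<lambda>v. real (c v) / real n)"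
    unfolding antipodal_coloring_def
  proof (intro allI impI)
    fix u v assume "(u, v) \<in> parcs G"
    from c[OF this] have uv: "int d \<le> \<bar>int (c u) - int (c v)\<bar>"
        "\<bar>int (c u) - int (c v)\<bar> \<le> int n - int d"
      by (auto simp: circular_complete_def)
    let ?t = "real (c v) / real n - real (c u) / real n"
    have t: "?t = real_of_int (int (c v) - int (c u)) / real n" by (simp add: diff_divide_distrib)
    show "\<exists>z::int. \<bar>?t - 1/2 - z\<bar> \<le> 1/2 - real d / real n"
    proof (cases "c u \<le> c v")
      case True
      with uv have "real d \<le> real_of_int (int (c v) - int (c u))"
        "real_of_int (int (c v) - int (c u)) \<le> real n - real d" by linarith+
      then have "real d / real n \<le> ?t" "?t \<le> (real n - real d) / real n"
        unfolding t using n by (auto intro!: divide_right_mono)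
      then have "real d / real n \<le> ?t" "?t \<le> 1 - real d / real n"
        using n by (auto simp: diff_divide_distrib)
      then show ?thesis by (intro exI[of _ 0]) (simp add: abs_le_iff)
    next
      case False
      with uv have "real_of_int (int (c v) - int (c u)) \<le> - real d"
        "- real n + real d \<le> real_of_int (int (c v) - int (c u))" by linarith+
      then have "?t \<le> (- real d) / real n" "(- real n + real d) / real n \<le> ?t"
        unfolding t using n by (metis divide_right_mono of_nat_0_le_iff)+
      then have "?t \<le> - (real d / real n)" "real d / real n - 1 \<le> ?t"
        using n by (auto simp: add_divide_distrib diff_divide_distrib)
      then show ?thesis by (intro exI[of _ "-1"]) (simp add: abs_le_iff)
    qed
  qed
  moreover have "real d / real n \<le> 1/2"
    using assms n by (auto simp: field_simps)
  ultimately show ?thesis using assms(2) n by (auto simp: antipodal_errors_def)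
qed

text \<open>Round each position down to a multiple of \<open>1/n\<close>. Rounding preserves the
  bounds on scaled differences because \<open>d\<close> and \<open>n - d\<close> are
  integers.\<close>

lemma homomorphic_if_antipodal_errors:
  assumes "\<epsilon> \<in> antipodal_errors (parcs G)" "real d / real n \<le> 1/2 - \<epsilon>" "0 < n"
  shows "homomorphic_to G (circular_complete n d)"
proof -
  obtain f where f: "antipodal_coloring (parcs G) \<epsilon> f" and \<epsilon>: "0 \<le> \<epsilon>" "\<epsilon> < 1/2"
    using assms(1) by (auto simp: antipodal_errors_def)
  define c where "c v = nat \<lfloor>real n * frac (f v)\<rfloor>" for v
  have int_c: "int (c v) = \<lfloor>real n * frac (f v)\<rfloor>" for v
    unfolding c_def by (simp add: frac_ge_0)
  have c_less: "c v < n" for v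
  proof -
    have "real n * frac (f v) < real n" using frac_lt_1[of "f v"] assms(3) by simp
    then have "\<lfloor>real n * frac (f v)\<rfloor> < int n" by linarith
    then show ?thesis using int_c[of v] by linarith
  qed
  have d: "real d \<le> real n * (1/2 - \<epsilon>)" using assms(2,3) by (simp add: field_simps)
  have gap: "int d \<le> int (c v) - int (c u) \<and> int (c v) - int (c u) \<le> int n - int d"
    if "1/2 - \<epsilon> \<le> frac (f v) - frac (f u)" "frac (f v) - frac (f u) \<le> 1/2 + \<epsilon>" for u v
  proof -
    have "real n * (1/2 - \<epsilon>) \<le> real n * (frac (f v) - frac (f u))"
      using that(1) by (intro mult_left_mono) auto
    then have 1: "real d \<le> real n * frac (f v) - real n * frac (f u)"
      using d by (simp add: right_diff_distrib)
    have "real n * (frac (f v) - frac (f u)) \<le> real n * (1/2 + \<epsilon>)"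
      using that(2) by (intro mult_left_mono) auto
    then have 2: "real n * frac (f v) - real n * frac (f u) \<le> real n - real d"
      using d by (simp add: algebra_simps)
    show ?thesis unfolding int_c using 1 2 by linarith
  qed
  have "(c u, c v) \<in> parcs (circular_complete n d)" if uv: "(u, v) \<in> parcs G" for u v
  proof -
    obtain y :: int where "\<bar>f v - f u - 1/2 - y\<bar> \<le> \<epsilon>"
      using f uv unfolding antipodal_coloring_def by blast
    then have "\<bar>frac (f v) - frac (f u) - 1/2 - of_int (y - \<lfloor>f v\<rfloor> + \<lfloor>f u\<rfloor>)\<bar> \<le> \<epsilon>"
      by (simp add: frac_def)
    then obtain z :: int where z: "\<bar>frac (f v) - frac (f u) - 1/2 - z\<bar> \<le> \<epsilon>" by blast
    have b: "0 \<le> frac (f v)" "frac (f v) < 1" "0 \<le> frac (f u)" "frac (f u) < 1"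
      by (simp_all add: frac_ge_0 frac_lt_1)
    \<comment> \<open>The fractional parts differ by less than 1 in absolute value, so
      \<open>z\<close> merely records which of the two is larger.\<close>
    have "of_int z < (1::real)" "of_int z > (-2::real)" using z b \<epsilon> by linarith+
    then have "z = 0 \<or> z = -1" by linarith
    then have "1/2 - \<epsilon> \<le> frac (f v) - frac (f u) \<and> frac (f v) - frac (f u) \<le> 1/2 + \<epsilon> \<or>
        1/2 - \<epsilon> \<le> frac (f u) - frac (f v) \<and> frac (f u) - frac (f v) \<le> 1/2 + \<epsilon>"
      using z by auto
    then show ?thesis
      using gap[of v u] gap[of u v] c_less by (auto simp: circular_complete_def)
  qed
  then show ?thesis
    unfolding homomorphic_to_def using c_less
    by (intro exI[of _ c]) (auto simp: circular_complete_def)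
qed

lemma bdd_below_antipodal_errors: "bdd_below (antipodal_errors R)"
  by (rule bdd_belowI[of _ 0]) (simp add: antipodal_errors_def)

lemma Inf_antipodal_errors:
  assumes "antipodal_errors R \<noteq> {}"
  shows "0 \<le> Inf (antipodal_errors R)" "Inf (antipodal_errors R) < 1/2"
proof -
  show "0 \<le> Inf (antipodal_errors R)"
    using assms by (intro cInf_greatest) (auto simp: antipodal_errors_def)
  obtain \<epsilon> where "\<epsilon> \<in> antipodal_errors R" using assms by blast
  then show "Inf (antipodal_errors R) < 1/2"
    using cInf_lower[OF _ bdd_below_antipodal_errors] by (fastforce simp: antipodal_errors_def)
qed

text \<open>A fraction \<open>n/d\<close> corresponds to the error \<open>1/2 - d/n\<close>. Optimal
  errors need not be attained or rational, so the upper bound is proved for every larger value, by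
  density.\<close>

lemma circular_chromatic_eq:
  assumes "antipodal_errors (parcs G) \<noteq> {}"
  shows "circular_chromatic G = ereal (1 / (1/2 - Inf (antipodal_errors (parcs G))))"
proof (rule antisym)
  let ?e = "Inf (antipodal_errors (parcs G))"
  have e: "0 \<le> ?e" "?e < 1/2" using Inf_antipodal_errors[OF assms] .
  show "ereal (1 / (1/2 - ?e)) \<le> circular_chromatic G"
    unfolding circular_chromatic_def
  proof (rule Inf_greatest)
    fix x assume "x \<in> {ereal (real n / real d) | n d.
      0 < d \<and> 2 * d \<le> n \<and> homomorphic_to G (circular_complete n d)}"
    then obtain n d where x: "x = ereal (real n / real d)" "0 < d" "2 * d \<le> n"
      "homomorphic_to G (circular_complete n d)" by blast
    have "?e \<le> 1/2 - real d / real n"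
      using antipodal_errors_if_homomorphic[OF x(4,2,3)] bdd_below_antipodal_errors by (rule cInf_lower)
    then have "real d / real n \<le> 1/2 - ?e" by linarith
    moreover have "0 < real d / real n" using x by simp
    ultimately have "1 / (1/2 - ?e) \<le> 1 / (real d / real n)" using e(2) by (intro frac_le) auto
    then show "ereal (1 / (1/2 - ?e)) \<le> x" using x by simp
  qed
  show "circular_chromatic G \<le> ereal (1 / (1/2 - ?e))"
  proof (rule dense_ge)
    fix x assume x: "ereal (1 / (1/2 - ?e)) < x"
    show "circular_chromatic G \<le> x"
    proof (cases x)
      case (real y)
      have pos: "0 < 1 / (1/2 - ?e)" using e by simp
      have y: "1 / (1/2 - ?e) < y" using x real by simp
      then have "0 < y" using pos by linarith
      then have "?e < 1/2 - 1/y" using y e by (simp add: field_simps)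
      then obtain \<epsilon> where \<epsilon>: "\<epsilon> \<in> antipodal_errors (parcs G)" "\<epsilon> < 1/2 - 1/y"
        using cInf_lessD[OF assms] by blast
      then have "1/y < 1/2 - \<epsilon>" by linarith
      \<comment> \<open>The rational \<open>q = d/n\<close> leaves room for the error
        \<open>\<epsilon>\<close>, which gives a homomorphism, while \<open>1/y < q\<close> gives
        \<open>n/d < y\<close>.\<close>
      from Rats_dense_in_real[OF this] obtain q where q: "q \<in> \<rat>" "1/y < q" "q < 1/2 - \<epsilon>" by blast
      obtain d n :: nat where dn: "n \<noteq> 0" "\<bar>q\<bar> = real d / real n"
        using q(1) by (rule Rats_abs_nat_div_natE)
      have "0 < 1/y" using \<open>0 < y\<close> by simp
      then have q_pos: "0 < q" using q(2) by linarith
      then have q_eq: "q = real d / real n" using dn by simp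
      have d: "0 < d" using q_pos q_eq by (cases d) auto
      have "0 \<le> \<epsilon>" using \<epsilon>(1) by (simp add: antipodal_errors_def)
      then have "real d / real n \<le> 1/2" using q(3) q_eq by linarith
      then have "2 * d \<le> n" using dn(1) by (simp add: field_simps)
      moreover have "homomorphic_to G (circular_complete n d)"
        using homomorphic_if_antipodal_errors[OF \<epsilon>(1)] q(3) q_eq dn(1) by simp
      ultimately have "circular_chromatic G \<le> ereal (real n / real d)"
        unfolding circular_chromatic_def using d by (intro Inf_lower) blast
      also have "real n / real d \<le> y"
        using q(2) \<open>0 < y\<close> d dn(1) unfolding q_eq by (simp add: field_simps)
      finally show ?thesis using real by simp
    qed (use x in auto)
  qed
qed

lemma antipodal_errors_nonempty:
  assumes "pair_graph G"
  shows "antipodal_errors (parcs G) \<noteq> {}"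
proof -
  interpret pair_graph G by fact
  obtain c where c: "bij_betw c (pverts G) {0..<card (pverts G)}"
    using ex_bij_betw_finite_nat[OF pair_finite_verts] by blast
  \<comment> \<open>All vertices get distinct colours in a complete graph; the summand 2 ensures
    \<open>2 * 1 \<le> ?n\<close> even for a graph without vertices.\<close>
  let ?n = "card (pverts G) + 2"
  have less: "c u < card (pverts G)" if "u \<in> pverts G" for u
    using c that by (auto simp: bij_betw_def)
  have "homomorphic_to G (circular_complete ?n 1)"
    unfolding homomorphic_to_def
  proof (intro exI[of _ c] conjI ballI)
    show "c \<in> pverts G \<rightarrow> pverts (circular_complete ?n 1)"
      using less by (force simp: circular_complete_def)
    fix e assume "e \<in> parcs G"
    then obtain u v where e: "e = (u, v)" "(u, v) \<in> parcs G" by (cases e) auto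
    then have uv: "u \<in> pverts G" "v \<in> pverts G" "u \<noteq> v"
      using in_arcsD1 in_arcsD2 no_loops' by blast+
    then have "c u \<noteq> c v" using c by (auto simp: bij_betw_def inj_on_def)
    then show "case e of (u, v) \<Rightarrow> (c u, c v) \<in> parcs (circular_complete ?n 1)"
      using less[OF uv(1)] less[OF uv(2)] e by (auto simp: circular_complete_def)
  qed
  from antipodal_errors_if_homomorphic[OF this] show ?thesis by auto
qed

section \<open>Walks in graph powers\<close>

lemma ex_cas_iff_relpow:
  "(\<exists>p. set p \<subseteq> parcs G \<and> pre_digraph.cas (with_proj G) u p v \<and> length p = k)
    \<longleftrightarrow> (u, v) \<in> parcs G ^^ k"
proof (induction k arbitrary: u)
  case 0
  then show ?case by (auto simp: pre_digraph.cas.simps)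
next
  case (Suc k)
  show ?case
  proof
    assume "\<exists>p. set p \<subseteq> parcs G \<and> pre_digraph.cas (with_proj G) u p v \<and> length p = Suc k"
    then obtain e p where "e \<in> parcs G" "set p \<subseteq> parcs G" "fst e = u"
      "pre_digraph.cas (with_proj G) (snd e) p v" "length p = k"
      by (auto simp: length_Suc_conv pre_digraph.cas.simps)
    then show "(u, v) \<in> parcs G ^^ Suc k" using Suc.IH by (metis prod.collapse relpow_Suc_I2)
  next
    assume "(u, v) \<in> parcs G ^^ Suc k"
    then obtain w where w: "(u, w) \<in> parcs G" "(w, v) \<in> parcs G ^^ k" by (meson relpow_Suc_D2)
    then obtain p where "set p \<subseteq> parcs G" "pre_digraph.cas (with_proj G) w p v" "length p = k"
      using Suc.IH by blast
    then show "\<exists>p. set p \<subseteq> parcs G \<and> pre_digraph.cas (with_proj G) u p v \<and> length p = Suc k"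
      using w by (intro exI[of _ "(u, w) # p"]) (simp add: pre_digraph.cas.simps)
  qed
qed

text \<open>For \<open>k = 0\<close> the two sides could differ: \<open>R ^^ 0\<close> is the
  identity on the whole type, whereas walks start at vertices of the graph.\<close>

lemma parcs_graph_power:
  assumes "pair_graph G" "0 < k"
  shows "parcs (graph_power G k) = parcs G ^^ k"
proof -
  interpret pair_graph G by fact
  have "u \<in> pverts G" if "(u, v) \<in> parcs G ^^ k" for u v
    using that assms(2) in_arcsD1 by (cases k) (auto simp del: relpow.simps dest!: relpow_Suc_D2)
  then show ?thesis
    using ex_cas_iff_relpow[of G _ _ k]
    by (auto simp: graph_power_def pre_digraph.awalk_def)
qed

section \<open>Scaling of the optimal error\<close>

text \<open>Scaling need only be valid below a threshold \<open>\<eta>\<close> that exceeds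
  \<open>c * Inf A\<close>, since elements close to the infimum decide the matter.\<close>

lemma Inf_scale_le:
  fixes A B :: "real set"
  assumes "A \<noteq> {}" "bdd_below B" "0 < c" "c * Inf A < \<eta>"
    and "\<And>\<epsilon>. \<epsilon> \<in> A \<Longrightarrow> c * \<epsilon> < \<eta> \<Longrightarrow> c * \<epsilon> \<in> B"
  shows "Inf B \<le> c * Inf A"
proof (rule dense_ge_bounded[OF assms(4)])
  fix w assume w: "c * Inf A < w" "w < \<eta>"
  then have "Inf A < w / c" using assms(3) by (simp add: field_simps)
  then obtain \<epsilon> where \<epsilon>: "\<epsilon> \<in> A" "\<epsilon> < w / c" using cInf_lessD[OF assms(1)] by blast
  then have "c * \<epsilon> < w" using assms(3) by (simp add: field_simps)
  then show "Inf B \<le> w"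
    using cInf_lower[OF assms(5)[OF \<epsilon>(1)] assms(2)] w by linarith
qed

lemma Inf_antipodal_errors_subdivision:
  assumes "pair_graph G" "odd s"
  shows "Inf (antipodal_errors (parcs (edge_subdivision G s)))
    = Inf (antipodal_errors (parcs G)) / real s"
proof -
  let ?G = "antipodal_errors (parcs G)" and ?H = "antipodal_errors (parcs (edge_subdivision G s))"
  have s: "1 \<le> real s" using assms(2) by (cases s) auto
  have sym: "sym (parcs G)" using assms(1) by (rule sym_parcs)
  have G: "?G \<noteq> {}" and H: "?H \<noteq> {}"
    using assms s by (auto intro!: antipodal_errors_nonempty pair_graph_edge_subdivision)
  have "Inf ?H \<le> 1 / real s * Inf ?G"
  proof (rule Inf_scale_le[OF G bdd_below_antipodal_errors])
    have "1 / real s * Inf ?G \<le> 1 * Inf ?G"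
      using s Inf_antipodal_errors[OF G] by (intro mult_right_mono) auto
    then show "1 / real s * Inf ?G < 1/2" using Inf_antipodal_errors[OF G] by linarith
    show "1 / real s * \<epsilon> \<in> ?H" if "\<epsilon> \<in> ?G" "1 / real s * \<epsilon> < 1/2" for \<epsilon>
      using that antipodal_coloring_subdivision[OF sym _ _ assms(2)] by (auto simp: antipodal_errors_def)
  qed (use s in simp)
  \<comment> \<open>This also keeps \<open>real s * Inf ?H\<close> below \<open>1/2\<close>, as the
    converse scaling requires.\<close>
  then have le: "real s * Inf ?H \<le> Inf ?G" using s by (simp add: field_simps)
  have "Inf ?G \<le> real s * Inf ?H"
  proof (rule Inf_scale_le[OF H bdd_below_antipodal_errors])
    show "real s * Inf ?H < 1/2" using le Inf_antipodal_errors[OF G] by linarith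
    show "real s * \<epsilon> \<in> ?G" if "\<epsilon> \<in> ?H" "real s * \<epsilon> < 1/2" for \<epsilon>
      using that antipodal_coloring_of_subdivision[OF _ assms(2)] by (auto simp: antipodal_errors_def)
  qed (use s in simp)
  with le show ?thesis using s by (simp add: field_simps)
qed

text \<open>Passing to the power multiplies errors by \<open>k\<close> as long as they stay below
  \<open>1/2\<close>. Passing back requires an error below \<open>1/4\<close>;
  \<open>\<epsilon>\<^sub>0\<close> guarantees that the infimum lies in that range.\<close>

lemma Inf_antipodal_errors_relpow:
  assumes "sym R" "odd k" "\<epsilon>\<^sub>0 \<in> antipodal_errors (R ^^ k)" "\<epsilon>\<^sub>0 < 1/4"
  shows "Inf (antipodal_errors (R ^^ k)) = real k * Inf (antipodal_errors R)"
proof -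
  let ?P = "antipodal_errors (R ^^ k)" and ?R = "antipodal_errors R"
  have k: "1 \<le> real k" using assms(2) by (cases k) auto
  have root: "1 / real k * \<epsilon> \<in> ?R" if \<epsilon>: "\<epsilon> \<in> ?P" "\<epsilon> < 1/4" for \<epsilon>
  proof -
    have "0 \<le> \<epsilon>" "\<exists>f. antipodal_coloring (R ^^ k) \<epsilon> f" using \<epsilon> by (auto simp: antipodal_errors_def)
    moreover have "\<epsilon> / real k \<le> \<epsilon> / 1" using k \<open>0 \<le> \<epsilon>\<close> by (intro divide_left_mono) auto
    ultimately show ?thesis
      using antipodal_coloring_root[OF assms(1,2)] \<epsilon>(2) k by (auto simp: antipodal_errors_def)
  qed
  have P: "?P \<noteq> {}" and R: "?R \<noteq> {}" using assms(3) root[OF assms(3,4)] by auto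
  have small: "Inf ?P < 1/4"
    using cInf_lower[OF assms(3) bdd_below_antipodal_errors] assms(4) by linarith
  have "Inf ?R \<le> 1 / real k * Inf ?P"
  proof (rule Inf_scale_le[OF P bdd_below_antipodal_errors])
    \<comment> \<open>The threshold is the bound \<open>1/4\<close> for taking roots, divided by
      \<open>k\<close>.\<close>
    show "1 / real k * Inf ?P < 1 / (4 * real k)" using small k by (simp add: field_simps)
    show "1 / real k * \<epsilon> \<in> ?R" if "\<epsilon> \<in> ?P" "1 / real k * \<epsilon> < 1 / (4 * real k)" for \<epsilon>
      using root[OF that(1)] that(2) k by (simp add: field_simps)
  qed (use k in simp)
  then have le: "real k * Inf ?R \<le> Inf ?P" using k by (simp add: field_simps)
  have "Inf ?P \<le> real k * Inf ?R"
  proof (rule Inf_scale_le[OF R bdd_below_antipodal_errors])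
    show "real k * Inf ?R < 1/2" using le small by linarith
    show "real k * \<epsilon> \<in> ?P" if "\<epsilon> \<in> ?R" "real k * \<epsilon> < 1/2" for \<epsilon>
      using that antipodal_coloring_odd_relpow[OF _ assms(2)] by (auto simp: antipodal_errors_def)
  qed (use k in simp)
  with le show ?thesis by linarith
qed

theorem theorem2:
  fixes G :: "'a pair_pre_digraph" and r s :: nat
  assumes "pair_graph G" and "\<not> bipartite G"
  shows "circular_chromatic (edge_subdivision G (2 * s + 1)) =
      ereal (2 * real s + 1) * circular_chromatic G / (ereal (real s) * circular_chromatic G + 1)
    \<and> (circular_chromatic (graph_power (edge_subdivision G (2 * s + 1)) (2 * r + 1)) < 4 \<longrightarrow>
       circular_chromatic (graph_power (edge_subdivision G (2 * s + 1)) (2 * r + 1)) =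
         ereal (2 * real s + 1) * circular_chromatic G
           / (ereal (real s - real r) * circular_chromatic G + ereal (2 * real r + 1)))"
proof (intro conjI impI)
  let ?H = "edge_subdivision G (2 * s + 1)"
  let ?P = "graph_power ?H (2 * r + 1)"
  define S K where "S = 2 * real s + 1" and "K = 2 * real r + 1"
  define e where "e = Inf (antipodal_errors (parcs G))"
  have S: "1 \<le> S" by (simp add: S_def)
  have H: "pair_graph ?H" using assms(1) by (simp add: pair_graph_edge_subdivision)
  have e: "0 \<le> e" "e < 1/2"
    using Inf_antipodal_errors[OF antipodal_errors_nonempty[OF assms(1)]] by (simp_all add: e_def)
  define c where "c = 1 / (1/2 - e)"
  have c: "circular_chromatic G = ereal c" "0 < c" "e = 1/2 - 1/c"
    using circular_chromatic_eq[OF antipodal_errors_nonempty[OF assms(1)]] e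
    by (simp_all add: e_def c_def)
  have eH: "Inf (antipodal_errors (parcs ?H)) = e / S"
    using Inf_antipodal_errors_subdivision[OF assms(1), of "2 * s + 1"] by (simp add: e_def S_def add_ac)
  \<comment> \<open>Both formulas are instances: \<open>k = 1\<close> gives the coefficient
    \<open>(S - 1) / 2 = s\<close> for the subdivision, and \<open>k = K\<close> gives
    \<open>s - r\<close> for its power.\<close>
  have chi: "ereal (1 / (1/2 - k * e / S)) = ereal S * ereal c / (ereal ((S - k) / 2) * ereal c + ereal k)"
    if "k * e / S < 1/2" for k
  proof -
    have eq: "(S - k) / 2 * c + k = S * c * (1/2 - k * e / S)"
    proof -
      have "c * e = c / 2 - 1" using c by (simp add: field_simps)
      moreover have "S * c * (1/2 - k * e / S) = S * c / 2 - k * (c * e)"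
        using S by (simp add: field_simps)
      ultimately have "S * c * (1/2 - k * e / S) = S * c / 2 - k * (c / 2 - 1)" by simp
      then show ?thesis by (simp add: field_simps)
    qed
    \<comment> \<open>The denominator is positive even if \<open>S - k\<close> is negative, so the
      extended real quotient is an ordinary real one.\<close>
    have x: "0 < 1/2 - k * e / S" using that by simp
    then have "0 < S * c * (1/2 - k * e / S)" using S c(2) by simp
    moreover have "1 / (1/2 - k * e / S) = S * c / (S * c * (1/2 - k * e / S))"
      using S c(2) by simp
    ultimately show ?thesis by (simp only: eq[symmetric] times_ereal.simps plus_ereal.simps ereal_divide) simp
  qed
  have "1 * e / S \<le> 1 * e / 1" using S e by (intro divide_left_mono) auto
  then have "1 * e / S < 1/2" using e by linarith
  from chi[OF this]
  show "circular_chromatic ?H =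
      ereal (2 * real s + 1) * circular_chromatic G / (ereal (real s) * circular_chromatic G + 1)"
    using circular_chromatic_eq[OF antipodal_errors_nonempty[OF H]]
    unfolding eH c(1) by (simp add: S_def one_ereal_def del: ereal_divide)
  assume "circular_chromatic ?P < 4"
  \<comment> \<open>An infimum below 4 is witnessed by some \<open>n/d < 4\<close>, that is, by an
    error \<open>1/2 - d/n\<close> below \<open>1/4\<close>, which is what the comparison with the
    power needs.\<close>
  then obtain n d where nd: "0 < d" "2 * d \<le> n" "homomorphic_to ?P (circular_complete n d)"
      "ereal (real n / real d) < 4"
    unfolding circular_chromatic_def Inf_less_iff by blast
  have P: "parcs ?P = parcs ?H ^^ (2 * r + 1)" using H by (intro parcs_graph_power) auto
  have sym: "sym (parcs ?H)" using H by (rule sym_parcs)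
  have nd4: "1/2 - real d / real n < 1/4"
    using nd(1,2,4) by (simp add: field_simps)
  have mem: "1/2 - real d / real n \<in> antipodal_errors (parcs ?P)"
    using antipodal_errors_if_homomorphic[OF nd(3,1,2)] .
  have eP: "Inf (antipodal_errors (parcs ?P)) = K * e / S"
    using Inf_antipodal_errors_relpow[OF sym _ mem[unfolded P] nd4]
    unfolding P eH by (simp add: K_def add_ac del: relpow.simps)
  have ne: "antipodal_errors (parcs ?P) \<noteq> {}" using mem by blast
  have "K * e / S < 1/2" using Inf_antipodal_errors(2)[OF ne] unfolding eP .
  have SK: "(S - K) / 2 = real s - real r" by (simp add: S_def K_def)
  from chi[OF \<open>K * e / S < 1/2\<close>] show "circular_chromatic ?P =
      ereal (2 * real s + 1) * circular_chromatic G
        / (ereal (real s - real r) * circular_chromatic G + ereal (2 * real r + 1))"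
    using circular_chromatic_eq[OF ne]
    unfolding eP c(1) SK by (simp add: S_def K_def del: ereal_divide)
qed

end
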